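(* The ring $D_q$ of $q$-differential operators on $R=\Bbbk[x]$ is a simple ring.
   Context: Let $q$ be transcendental over $\mathbb{Q}$, let $\Bbbk$ be a field containing $\mathbb{Q}(q)$, and let $R=\Bbbk[x]$ be $\mathbb{Z}$-graded by $\deg x^a=a$, with bicharacter $\beta(n,m)=q^{nm}$ on $\mathbb{Z}$. A $\Bbbk$-linear endomorphism $\varphi$ of $R$ is homogeneous of degree $d\in\mathbb{Z}$ if $\varphi(R_b)\subseteq R_{b+d}$ for all $b\in\mathbb Z$, where $R_b=\Bbbk x^b$ for $b\ge0$ and $R_b=0$ for $b<0$. $\mathrm{grHom}_\Bbbk(R,R)$ is the space of finite sums of homogeneous endomorphisms. Each $r\in R$ is identified with the operator of multiplication by $r$; $\mathrm{grHom}_\Bbbk(R,R)$ is an $R$-bimodule via composition. For $a\in\mathbb{Z}$ put $\widetilde\sigma_a(\psi)=q^{ad}\psi$ for $\psi$ homogeneous of degree $d$ (extended linearly), and $[\varphi,\psi]_a=\varphi\psi-\widetilde\sigma_a(\psi)\varphi$. $q$-differential operators: $D_q^0$ is the smallest $R$-sub-bimodule of $\mathrm{grHom}_\Bbbk(R,R)$ containing all homogeneous $\varphi$ for which there is $a\in\mathbb{Z}$ with $[\varphi,r]_a=0$ for all $r\in R$. Inductively, $D_q^{n+1}$ is the smallest $R$-sub-bimodule containing all homogeneous $\varphi$ for which there is $a\in\mathbb{Z}$ with $[\varphi,r]_a\in D_q^n$ for all $r\in R$. Put $D_q=\bigcup_{n\ge 0} D_q^n$; it is a ring under composition. *)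

theory Defs
  imports "HOL-Computational_Algebra.Polynomial" "HOL-Algebra.Ideal"
begin

section \<open>Graded endomorphisms of the polynomial ring\<close>

text \<open>
  The algebra \<open>R = k[x]\<close> is the type \<^typ>\<open>'k poly\<close>, and the operator of multiplication by \<open>r\<close>
  is the section \<open>(*) r\<close>.
\<close>

definition graded_piece :: "int \<Rightarrow> 'k::field poly set" where
  "graded_piece b = (if b < 0 then {0} else range (\<lambda>c. monom c (nat b)))"

definition homogeneous :: "int \<Rightarrow> ('k::field poly \<Rightarrow> 'k poly) \<Rightarrow> bool" where
  "homogeneous d \<phi> \<longleftrightarrow> Vector_Spaces.linear smult smult \<phi> \<and>
     (\<forall>b. \<phi> ` graded_piece b \<subseteq> graded_piece (b + d))"

definition grHom :: "('k::field poly \<Rightarrow> 'k poly) set" where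
  "grHom = {\<phi>. \<exists>(n::nat) d f. (\<forall>i<n. homogeneous (d i) (f i)) \<and> \<phi> = (\<lambda>p. \<Sum>i<n. f i p)}"

definition graded_proj :: "int \<Rightarrow> 'k::field poly \<Rightarrow> 'k poly" where
  "graded_proj b p = (if b < 0 then 0 else monom (coeff p (nat b)) (nat b))"

text \<open>
  The component of degree \<open>d\<close> of an endomorphism \<open>\<phi>\<close>: it sends the degree \<open>b\<close> part of its argument
  to the degree \<open>b + d\<close> part of the image of that part.
\<close>

definition hom_component ::
    "int \<Rightarrow> ('k::field poly \<Rightarrow> 'k poly) \<Rightarrow> 'k poly \<Rightarrow> 'k poly" where
  "hom_component d \<phi> p =
     (\<Sum>b\<le>degree p. graded_proj (int b + d) (\<phi> (graded_proj (int b) p)))"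

text \<open>
  The linear extension to \<^const>\<open>grHom\<close> of \<open>\<psi> \<mapsto> q\<^sup>a\<^sup>d \<psi>\<close> for \<open>\<psi>\<close> homogeneous of degree \<open>d\<close>; lemma
  \<open>qsigma_sum_homogeneous\<close> below states this property. Outside \<^const>\<open>grHom\<close> the index set may be
  infinite, and the value is irrelevant.
\<close>

definition qsigma ::
    "'k::field \<Rightarrow> int \<Rightarrow> ('k poly \<Rightarrow> 'k poly) \<Rightarrow> 'k poly \<Rightarrow> 'k poly" where
  "qsigma q a \<psi> p =
     (\<Sum>d | hom_component d \<psi> \<noteq> (\<lambda>_. 0). smult (q powi (a * d)) (hom_component d \<psi> p))"

definition qcommutator ::
    "'k::field \<Rightarrow> int \<Rightarrow> ('k poly \<Rightarrow> 'k poly) \<Rightarrow> ('k poly \<Rightarrow> 'k poly) \<Rightarrow> 'k poly \<Rightarrow> 'k poly" where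
  "qcommutator q a \<phi> \<psi> = (\<lambda>p. \<phi> (\<psi> p) - qsigma q a \<psi> (\<phi> p))"

lemma smult_sum_right: "smult c (\<Sum>i\<in>I. g i) = (\<Sum>i\<in>I. smult c (g i))"
  by (induction I rule: infinite_finite_induct) (simp_all add: smult_add_right)

lemma poly_eq_sum_graded_proj: "(\<Sum>b\<le>degree p. graded_proj (int b) p) = p"
  by (simp add: graded_proj_def poly_as_sum_of_monoms)

lemma graded_proj_sum: "graded_proj e (\<Sum>i\<in>I. g i) = (\<Sum>i\<in>I. graded_proj e (g i))"
  by (simp add: graded_proj_def coeff_sum monom_sum)

lemma graded_proj_graded_piece:
  assumes "p \<in> graded_piece c"
  shows "graded_proj e p = (if e = c then p else 0)"
  using assms by (auto simp: graded_proj_def graded_piece_def nat_eq_iff split: if_splits)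

lemma graded_proj_in: "graded_proj b p \<in> graded_piece b"
  by (auto simp: graded_proj_def graded_piece_def)

lemma hom_component_sum:
  "hom_component e (\<lambda>p. \<Sum>i\<in>I. f i p) = (\<lambda>p. \<Sum>i\<in>I. hom_component e (f i) p)"
  unfolding hom_component_def graded_proj_sum by (rule ext, rule sum.swap)

lemma hom_component_homogeneous:
  assumes "homogeneous d \<phi>"
  shows "hom_component e \<phi> = (\<lambda>p. if e = d then \<phi> p else 0)"
proof
  fix p
  interpret Vector_Spaces.linear smult smult \<phi>
    using assms by (simp add: homogeneous_def)
  have "\<phi> (graded_proj b p) \<in> graded_piece (b + d)" for b
    using assms graded_proj_in[of b p] by (auto simp: homogeneous_def)
  from graded_proj_graded_piece[OF this]
  have "graded_proj (b + e) (\<phi> (graded_proj b p)) =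
      (if e = d then \<phi> (graded_proj b p) else 0)" for b
    by simp
  hence "hom_component e \<phi> p = (if e = d then \<phi> (\<Sum>b\<le>degree p. graded_proj (int b) p) else 0)"
    by (simp add: hom_component_def sum)
  thus "hom_component e \<phi> p = (if e = d then \<phi> p else 0)"
    by (simp add: poly_eq_sum_graded_proj)
qed

lemma qsigma_sum_homogeneous:
  assumes "\<forall>i<n. homogeneous (d i) (f i)"
  shows "qsigma q a (\<lambda>p. \<Sum>i<(n::nat). f i p) = (\<lambda>p. \<Sum>i<n. smult (q powi (a * d i)) (f i p))"
proof
  fix p
  let ?\<psi> = "\<lambda>p. \<Sum>i<n. f i p"
  have comp: "hom_component e ?\<psi> = (\<lambda>p. \<Sum>i<n. if e = d i then f i p else 0)" for e
    unfolding hom_component_sum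
  proof (intro ext sum.cong refl)
    fix p i assume "i \<in> {..<n}"
    hence "homogeneous (d i) (f i)" using assms by blast
    from hom_component_homogeneous[OF this, of e]
    show "hom_component e (f i) p = (if e = d i then f i p else 0)" by (rule fun_cong)
  qed
  have sub: "{e. hom_component e ?\<psi> \<noteq> (\<lambda>_. 0)} \<subseteq> d ` {..<n}"
  proof
    fix e assume "e \<in> {e. hom_component e ?\<psi> \<noteq> (\<lambda>_. 0)}"
    hence "(\<lambda>p. \<Sum>i<n. if e = d i then f i p else 0) \<noteq> (\<lambda>_. 0)"
      unfolding comp by simp
    then obtain p where "(\<Sum>i<n. if e = d i then f i p else 0) \<noteq> 0"
      by blast
    then obtain i where "i < n" "(if e = d i then f i p else 0) \<noteq> 0"
      by (auto elim: sum.not_neutral_contains_not_neutral)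
    thus "e \<in> d ` {..<n}" by (auto split: if_splits)
  qed
  have "qsigma q a ?\<psi> p =
      (\<Sum>e\<in>d ` {..<n}. smult (q powi (a * e)) (hom_component e ?\<psi> p))"
    unfolding qsigma_def
  proof (rule sum.mono_neutral_left[OF _ sub], simp, rule ballI)
    fix e assume "e \<in> d ` {..<n} - {e. hom_component e ?\<psi> \<noteq> (\<lambda>_. 0)}"
    hence "hom_component e ?\<psi> = (\<lambda>_. 0)" by blast
    from fun_cong[OF this, of p]
    show "smult (q powi (a * e)) (hom_component e ?\<psi> p) = 0" by (simp only: smult_0_right)
  qed
  also have "\<dots> = (\<Sum>e\<in>d ` {..<n}. \<Sum>i<n. smult (q powi (a * e)) (if e = d i then f i p else 0))"
    unfolding comp by (simp only: smult_sum_right)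
  also have "\<dots> = (\<Sum>i<n. \<Sum>e\<in>d ` {..<n}. smult (q powi (a * e)) (if e = d i then f i p else 0))"
    by (rule sum.swap)
  also have "\<dots> = (\<Sum>i<n. \<Sum>e\<in>d ` {..<n}. if e = d i then smult (q powi (a * e)) (f i p) else 0)"
    by (intro sum.cong refl) auto
  also have "\<dots> = (\<Sum>i<n. smult (q powi (a * d i)) (f i p))"
    by (intro sum.cong refl) (simp add: sum.delta)
  finally show "qsigma q a ?\<psi> p = (\<Sum>i<n. smult (q powi (a * d i)) (f i p))" .
qed


section \<open>The ring of $q$-differential operators\<close>

definition sub_bimodule :: "('k::field poly \<Rightarrow> 'k poly) set \<Rightarrow> bool" where
  "sub_bimodule M \<longleftrightarrow> M \<subseteq> grHom \<and> (\<lambda>_. 0) \<in> M \<and>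
     (\<forall>\<phi>\<in>M. \<forall>\<psi>\<in>M. (\<lambda>p. \<phi> p + \<psi> p) \<in> M) \<and>
     (\<forall>\<phi>\<in>M. \<forall>r. (*) r \<circ> \<phi> \<in> M \<and> \<phi> \<circ> (*) r \<in> M)"

primrec qdiff_upto :: "'k::field \<Rightarrow> nat \<Rightarrow> ('k poly \<Rightarrow> 'k poly) set" where
  "qdiff_upto q 0 =
     sub_bimodule hull
       {\<phi>. (\<exists>d. homogeneous d \<phi>) \<and> (\<exists>a. \<forall>r. qcommutator q a \<phi> ((*) r) = (\<lambda>_. 0))}"
| "qdiff_upto q (Suc n) =
     sub_bimodule hull
       {\<phi>. (\<exists>d. homogeneous d \<phi>) \<and> (\<exists>a. \<forall>r. qcommutator q a \<phi> ((*) r) \<in> qdiff_upto q n)}"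

definition qdiff_ring :: "'k::field \<Rightarrow> ('k poly \<Rightarrow> 'k poly) ring" where
  "qdiff_ring q =
     \<lparr>carrier = (\<Union>n. qdiff_upto q n), mult = (\<circ>), one = id,
      zero = (\<lambda>_. 0), add = (\<lambda>\<phi> \<psi> p. \<phi> p + \<psi> p)\<rparr>"

text \<open>The locale \<^locale>\<open>ideal\<close> is that of two-sided ideals of a not necessarily commutative ring.\<close>

definition simple_ring :: "('a, 'b) ring_scheme \<Rightarrow> bool" where
  "simple_ring S \<longleftrightarrow> ring S \<and> carrier S \<noteq> {\<zero>\<^bsub>S\<^esub>} \<and>
     (\<forall>I. ideal I S \<longrightarrow> I = {\<zero>\<^bsub>S\<^esub>} \<or> I = carrier S)"

end

theory Submission
  imports Defs
begin

text \<open>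
  For an endomorphism \<open>\<phi>\<close> of \<open>R = k[x]\<close> put \<open>T\<^sub>a \<phi> = \<phi> x - q\<^sup>a x \<phi>\<close>, which is the twisted commutator
  \<open>[\<phi>, x]\<^sub>a\<close>. The operators \<open>T\<^sub>a\<close> commute with one another, because left and right multiplication by
  \<open>x\<close> do.

  Every element of \<open>D\<^sub>q\<close> is annihilated by some product \<open>T\<^sub>b \<dots> T\<^sub>c\<close>: the endomorphisms with this
  property form an \<open>R\<close>-bimodule and contain the generators of each \<open>D\<^sub>q\<^sup>n\<close>. Conversely, every graded
  endomorphism annihilated in this way lies in \<open>D\<^sub>q\<close>: its homogeneous components inherit the property,
  and for homogeneous \<open>\<phi>\<close> the condition on \<open>[\<phi>, x]\<^sub>a\<close> propagates to all \<open>[\<phi>, r]\<^sub>a\<close>. So \<open>D\<^sub>q\<close> is the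
  set of graded endomorphisms killed by a product of \<open>T\<^sub>a\<close>'s (lemma \<open>Union_qdiff_upto\<close>). In this
  description closure under composition follows from a Leibniz rule for \<open>T\<^sub>a\<^sub>+\<^sub>b (\<phi> \<psi>)\<close>
  (lemma \<open>qtwist_compose\<close>).

  Let \<open>I\<close> be a nonzero two-sided ideal. It contains \<open>x \<phi>\<close> and \<open>\<phi> x\<close> along with \<open>\<phi>\<close>, so it is closed under
  every \<open>T\<^sub>a\<close>. Applying the factors of an annihilating product to a nonzero element one after the other,
  one meets a last nonzero element \<open>\<psi> \<in> I\<close>, and \<open>T\<^sub>a \<psi> = 0\<close> for some \<open>a\<close>. This means \<open>\<psi> = \<psi>(1) \<sigma>\<^sub>a\<close>, where
  \<open>\<sigma>\<^sub>a\<close> is the automorphism \<open>x \<mapsto> q\<^sup>a x\<close> of \<open>R\<close>. Both \<open>\<sigma>\<^sub>-\<^sub>a\<close> and the derivative \<open>\<partial>\<close> belong to \<open>D\<^sub>q\<close>. Hence \<open>I\<close>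
  contains the multiplication by the nonzero polynomial \<open>\<psi>(1)\<close>, and with each polynomial \<open>r\<close> it
  contains \<open>\<partial> r - r \<partial> = r'\<close>. In characteristic zero iterated derivatives of \<open>\<psi>(1)\<close> reach a nonzero
  constant, so \<open>I\<close> is the whole ring.
\<close>

section \<open>Homogeneous endomorphisms and their sums\<close>

lemma linear_smult_iff:
  "Vector_Spaces.linear smult smult (\<phi> :: 'k::field poly \<Rightarrow> 'k poly) \<longleftrightarrow>
     (\<forall>p p'. \<phi> (p + p') = \<phi> p + \<phi> p') \<and> (\<forall>c p. \<phi> (smult c p) = smult c (\<phi> p))"
proof -
  have "vector_space (smult :: 'k \<Rightarrow> 'k poly \<Rightarrow> 'k poly)"
    by standard (simp_all add: smult_add_right smult_add_left)
  then show ?thesis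
    by (simp add: Vector_Spaces.linear_iff)
qed

text \<open>
  The coefficientwise form treats negative and nonnegative degrees uniformly: in negative degree the
  condition ranges over all coefficients.
\<close>

lemma graded_piece_iff: "p \<in> graded_piece b \<longleftrightarrow> (\<forall>i. int i \<noteq> b \<longrightarrow> coeff p i = 0)"
proof (cases "b < 0")
  case True
  then show ?thesis
    by (auto simp: graded_piece_def poly_eq_iff)
next
  case False
  have "(\<exists>c. p = monom c (nat b)) \<longleftrightarrow> (\<forall>i. int i \<noteq> b \<longrightarrow> coeff p i = 0)"
  proof
    assume "\<forall>i. int i \<noteq> b \<longrightarrow> coeff p i = 0"
    then have "p = monom (coeff p (nat b)) (nat b)"
      using False by (auto simp: poly_eq_iff)
    then show "\<exists>c. p = monom c (nat b)" ..
  qed (use False in auto)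
  then show ?thesis
    using False by (auto simp: graded_piece_def)
qed

lemma homogeneous_iff:
  "homogeneous d \<phi> \<longleftrightarrow>
     (\<forall>p p'. \<phi> (p + p') = \<phi> p + \<phi> p') \<and> (\<forall>c p. \<phi> (smult c p) = smult c (\<phi> p)) \<and>
     (\<forall>b. \<forall>p\<in>graded_piece b. \<phi> p \<in> graded_piece (b + d))"
  unfolding homogeneous_def linear_smult_iff by (simp only: image_subset_iff conj_assoc)

lemma homogeneous_zero: "homogeneous d (\<lambda>_. 0)"
  by (simp add: homogeneous_iff graded_piece_iff)

lemma homogeneous_add:
  "homogeneous d \<phi> \<Longrightarrow> homogeneous d \<psi> \<Longrightarrow> homogeneous d (\<lambda>p. \<phi> p + \<psi> p)"
  by (simp add: homogeneous_iff graded_piece_iff smult_add_right)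

lemma homogeneous_compose:
  assumes "homogeneous d \<phi>" "homogeneous e \<psi>"
  shows "homogeneous (e + d) (\<phi> \<circ> \<psi>)"
  unfolding homogeneous_iff add.assoc[symmetric]
proof (intro conjI allI ballI)
  fix b and p :: "'a poly"
  assume "p \<in> graded_piece b"
  then show "(\<phi> \<circ> \<psi>) p \<in> graded_piece (b + e + d)"
    using assms unfolding homogeneous_iff by auto
qed (use assms in \<open>simp_all add: homogeneous_iff\<close>)

lemma homogeneous_smult: "homogeneous 0 (smult c)"
  by (simp add: homogeneous_iff graded_piece_iff smult_add_right mult.commute)

lemma homogeneous_mult_monom: "homogeneous (int k) ((*) (monom c k))"
  by (auto simp: homogeneous_iff graded_piece_iff distrib_left coeff_monom_mult)

lemma homogeneous_pCons_0: "homogeneous 1 (pCons 0)"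
proof -
  have "(*) (monom 1 1) = (pCons 0 :: 'a poly \<Rightarrow> _)"
    by (simp add: monom_Suc fun_eq_iff)
  then show ?thesis
    using homogeneous_mult_monom[of 1 "1 :: 'a"] by simp
qed

lemma grHomI: "(\<And>i. i < n \<Longrightarrow> homogeneous (d i) (f i)) \<Longrightarrow> (\<lambda>p. \<Sum>i<(n::nat). f i p) \<in> grHom"
  unfolding grHom_def by (rule CollectI, rule exI[of _ n], rule exI[of _ d], rule exI[of _ f]) simp

lemma grHom_homogeneous: "homogeneous d \<phi> \<Longrightarrow> \<phi> \<in> grHom"
  using grHomI[of 1 "\<lambda>_. d" "\<lambda>_. \<phi>"] by simp

lemma grHom_induct [consumes 1, case_names zero add]:
  assumes "\<phi> \<in> grHom"
    and "P (\<lambda>_. 0)"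
    and "\<And>\<phi> \<psi> d. \<phi> \<in> grHom \<Longrightarrow> P \<phi> \<Longrightarrow> homogeneous d \<psi> \<Longrightarrow> P (\<lambda>p. \<phi> p + \<psi> p)"
  shows "P \<phi>"
proof -
  obtain n :: nat and d f where f: "\<forall>i<n. homogeneous (d i) (f i)"
    and \<phi>: "\<phi> = (\<lambda>p. \<Sum>i<n. f i p)"
    using assms(1) by (auto simp: grHom_def)
  have "P (\<lambda>p. \<Sum>i<m. f i p)" if "m \<le> n" for m
    using that
  proof (induction m)
    case 0
    show ?case using assms(2) by simp
  next
    case (Suc m)
    have "(\<lambda>p. \<Sum>i<m. f i p) \<in> grHom"
      using f Suc.prems by (intro grHomI[of m d f]) simp
    then show ?case
      using assms(3)[of "\<lambda>p. \<Sum>i<m. f i p" "d m" "f m"] f Suc by simp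
  qed
  then show ?thesis using \<phi> by simp
qed

lemma grHom_add_homogeneous:
  assumes "\<phi> \<in> grHom" "homogeneous d \<psi>"
  shows "(\<lambda>p. \<phi> p + \<psi> p) \<in> grHom"
proof -
  obtain n :: nat and e f where f: "\<forall>i<n. homogeneous (e i) (f i)"
    and \<phi>: "\<phi> = (\<lambda>p. \<Sum>i<n. f i p)"
    using assms(1) by (auto simp: grHom_def)
  have "(\<lambda>p. \<Sum>i<Suc n. (f(n := \<psi>)) i p) \<in> grHom"
    using f assms(2) by (intro grHomI[of _ "e(n := d)"]) (auto simp: less_Suc_eq)
  then show ?thesis
    by (simp add: \<phi>)
qed

lemma grHom_add:
  assumes "\<phi> \<in> grHom" "\<psi> \<in> grHom"
  shows "(\<lambda>p. \<phi> p + \<psi> p) \<in> grHom"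
  using assms(2)
proof (induction \<psi> rule: grHom_induct)
  case (add \<psi> \<chi> d)
  then show ?case
    using grHom_add_homogeneous[of "\<lambda>p. \<phi> p + \<psi> p" d \<chi>] by (simp add: add.assoc)
qed (use assms(1) in simp)

lemma grHom_linear:
  assumes "\<phi> \<in> grHom"
  shows "\<phi> (p + p') = \<phi> p + \<phi> p'" "\<phi> (smult c p) = smult c (\<phi> p)"
proof -
  have "(\<forall>p p'. \<phi> (p + p') = \<phi> p + \<phi> p') \<and> (\<forall>c p. \<phi> (smult c p) = smult c (\<phi> p))"
    using assms by (induction rule: grHom_induct) (simp_all add: homogeneous_iff smult_add_right)
  then show "\<phi> (p + p') = \<phi> p + \<phi> p'" "\<phi> (smult c p) = smult c (\<phi> p)"
    by blast+
qed

lemma grHom_diff: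
  assumes "\<phi> \<in> grHom"
  shows "\<phi> (p - p') = \<phi> p - \<phi> p'"
  using grHom_linear(1)[OF assms, of "p - p'" p'] by simp

lemma grHom_eq_0: "\<phi> \<in> grHom \<Longrightarrow> \<phi> 0 = 0"
  using grHom_linear(2)[of \<phi> 0 0] by simp

lemma grHom_compose:
  assumes "\<phi> \<in> grHom" "\<psi> \<in> grHom"
  shows "\<phi> \<circ> \<psi> \<in> grHom"
  using assms
proof (induction arbitrary: \<psi> rule: grHom_induct)
  case zero
  then show ?case
    by (simp add: o_def grHom_homogeneous[OF homogeneous_zero])
next
  case (add \<phi> \<chi> d)
  from add.prems have "\<chi> \<circ> \<psi> \<in> grHom"
  proof (induction rule: grHom_induct)
    case zero
    then show ?case
      using grHom_eq_0[OF grHom_homogeneous[OF add.hyps(2)]]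
      by (simp add: o_def grHom_homogeneous[OF homogeneous_zero])
  next
    case (add \<psi> \<psi>' e)
    from grHom_add_homogeneous[OF add.IH homogeneous_compose[OF \<open>homogeneous d \<chi>\<close> add.hyps(2)]]
    show ?case
      using grHom_linear(1)[OF grHom_homogeneous[OF \<open>homogeneous d \<chi>\<close>]] by (simp add: o_def)
  qed
  from grHom_add[OF add.IH[OF add.prems] this] show ?case
    by (simp add: o_def)
qed

lemma grHom_mult: "(*) r \<in> grHom"
proof -
  have "(*) r = (\<lambda>p. \<Sum>i<Suc (degree r). (*) (monom (coeff r i) i) p)"
    by (simp add: lessThan_Suc_atMost poly_as_sum_of_monoms flip: sum_distrib_right)
  also have "\<dots> \<in> grHom"
    by (intro grHomI[of _ int] homogeneous_mult_monom)
  finally show ?thesis .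
qed

lemma sub_bimodule_grHom: "sub_bimodule grHom"
  unfolding sub_bimodule_def
  using grHom_homogeneous[OF homogeneous_zero] grHom_add grHom_compose grHom_mult by blast

lemma sub_bimoduleD:
  assumes "sub_bimodule M"
  shows "(\<lambda>_. 0) \<in> M"
    and "\<phi> \<in> M \<Longrightarrow> \<psi> \<in> M \<Longrightarrow> (\<lambda>p. \<phi> p + \<psi> p) \<in> M"
    and "\<phi> \<in> M \<Longrightarrow> (*) r \<circ> \<phi> \<in> M"
    and "\<phi> \<in> M \<Longrightarrow> \<phi> \<circ> (*) r \<in> M"
proof -
  note * = assms[unfolded sub_bimodule_def, THEN conjunct2]
  show "(\<lambda>_. 0) \<in> M"
    by (rule *[THEN conjunct1])
  show "(\<lambda>p. \<phi> p + \<psi> p) \<in> M" if "\<phi> \<in> M" "\<psi> \<in> M"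
    using *[THEN conjunct2, THEN conjunct1, THEN bspec, OF that(1), THEN bspec, OF that(2)] .
  show "(*) r \<circ> \<phi> \<in> M" "\<phi> \<circ> (*) r \<in> M" if "\<phi> \<in> M"
    using *[THEN conjunct2, THEN conjunct2, THEN bspec, OF that, THEN spec, of r]
    by (rule conjunct1, rule conjunct2)
qed

section \<open>Homogeneous components\<close>

lemma hom_component_add:
  "hom_component e (\<lambda>p. \<phi> p + \<psi> p) = (\<lambda>p. hom_component e \<phi> p + hom_component e \<psi> p)"
proof -
  have "graded_proj b (p + p') = graded_proj b p + graded_proj b p'" for b and p p' :: "'a poly"
    by (simp add: graded_proj_def add_monom)
  then show ?thesis
    by (simp add: hom_component_def sum.distrib fun_eq_iff)
qed

lemma hom_component_zero: "hom_component e (\<lambda>_. 0) = (\<lambda>_. 0)"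
  by (rule hom_component_homogeneous[OF homogeneous_zero, of _ e, simplified])

lemma homogeneous_hom_component:
  "\<phi> \<in> grHom \<Longrightarrow> homogeneous e (hom_component e \<phi>)"
proof (induction rule: grHom_induct)
  case zero
  then show ?case by (simp add: hom_component_zero homogeneous_zero)
next
  case (add \<phi> \<psi> d)
  have "homogeneous e (hom_component e \<psi>)"
    using add.hyps(2) by (cases "e = d") (simp_all add: hom_component_homogeneous homogeneous_zero)
  with add.IH show ?case
    by (simp add: hom_component_add homogeneous_add)
qed

text \<open>
  In the induction the representation is claimed for every sufficiently large finite index set, so that
  the index sets belonging to two summands can be replaced by a common one.
\<close>

lemma sum_hom_component:
  assumes "\<phi> \<in> grHom"
  obtains E where "finite E" "\<phi> = (\<lambda>p. \<Sum>e\<in>E. hom_component e \<phi> p)"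
proof -
  have "\<exists>E. finite E \<and> (\<forall>F. E \<subseteq> F \<longrightarrow> finite F \<longrightarrow> \<phi> = (\<lambda>p. \<Sum>e\<in>F. hom_component e \<phi> p))"
    using assms
  proof (induction rule: grHom_induct)
    case zero
    then show ?case by (auto simp: hom_component_zero)
  next
    case (add \<phi> \<psi> d)
    then obtain E where E: "finite E"
      "\<And>F. E \<subseteq> F \<Longrightarrow> finite F \<Longrightarrow> \<phi> = (\<lambda>p. \<Sum>e\<in>F. hom_component e \<phi> p)"
      by blast
    have "(\<lambda>p. \<phi> p + \<psi> p) = (\<lambda>p. \<Sum>e\<in>F. hom_component e (\<lambda>p. \<phi> p + \<psi> p) p)"
      if F: "insert d E \<subseteq> F" "finite F" for F
    proof
      fix p
      have "(\<Sum>e\<in>F. hom_component e \<phi> p) = \<phi> p"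
        using fun_cong[OF E(2)[of F], of p] F by simp
      moreover have "(\<Sum>e\<in>F. hom_component e \<psi> p) = \<psi> p"
        using F by (simp add: hom_component_homogeneous[OF add.hyps(2)] sum.delta)
      ultimately show "\<phi> p + \<psi> p = (\<Sum>e\<in>F. hom_component e (\<lambda>p. \<phi> p + \<psi> p) p)"
        by (simp add: hom_component_add sum.distrib)
    qed
    then show ?case
      using E(1) by (intro exI[of _ "insert d E"]) simp
  qed
  then show ?thesis using that by blast
qed

section \<open>Twisted commutators\<close>

text \<open>
  The automorphism \<open>\<sigma>\<^sub>a\<close> of \<open>k[x]\<close> with \<open>x \<mapsto> q\<^sup>a x\<close>. On multiplication operators, \<^const>\<open>qsigma\<close> acts
  through it.
\<close>

definition qscale :: "'k::field \<Rightarrow> int \<Rightarrow> 'k poly \<Rightarrow> 'k poly" where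
  "qscale q a p = pcompose p [:0, q powi a:]"

lemma coeff_qscale: "coeff (qscale q a p) i = (q powi a) ^ i * coeff p i"
  by (simp add: qscale_def coeff_pcompose_linear)

lemma qscale_pCons: "qscale q a (pCons c p) = [:c:] + smult (q powi a) (pCons 0 (qscale q a p))"
  by (simp add: qscale_def pcompose_pCons)

lemma qsigma_mult:
  fixes q :: "'k::field"
  shows "qsigma q a ((*) r) p = qscale q a r * p"
proof -
  have r: "(*) r = (\<lambda>p. \<Sum>i<Suc (degree r). (*) (monom (coeff r i) i) p)"
    by (simp add: lessThan_Suc_atMost poly_as_sum_of_monoms flip: sum_distrib_right)
  have "qsigma q a ((*) r) =
      (\<lambda>p. \<Sum>i<Suc (degree r). smult (q powi (a * int i)) ((*) (monom (coeff r i) i) p))"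
    by (subst r, rule qsigma_sum_homogeneous) (simp add: homogeneous_mult_monom)
  moreover have "qscale q a r = (\<Sum>i<Suc (degree r). smult (q powi (a * int i)) (monom (coeff r i) i))"
  proof (rule poly_eqI)
    fix k
    have "coeff (\<Sum>i<Suc (degree r). smult (q powi (a * int i)) (monom (coeff r i) i)) k
        = (\<Sum>i<Suc (degree r). if i = k then (q powi a) ^ k * coeff r k else 0)"
      unfolding coeff_sum by (intro sum.cong) (auto simp: power_int_mult)
    also have "\<dots> = coeff (qscale q a r) k"
      by (auto simp: coeff_qscale sum.delta coeff_eq_0 simp del: sum.lessThan_Suc)
    finally show "coeff (qscale q a r) k =
        coeff (\<Sum>i<Suc (degree r). smult (q powi (a * int i)) (monom (coeff r i) i)) k" ..
  qed
  ultimately show ?thesis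
    by (simp add: sum_distrib_right distrib_right del: sum.lessThan_Suc)
qed

text \<open>
  This is \<open>[\<phi>, x]\<^sub>a\<close>, see lemma \<open>qcommutator_X\<close>: multiplication by \<open>x\<close> is \<^term>\<open>pCons 0\<close>.
\<close>

definition qtwist :: "'k::field \<Rightarrow> int \<Rightarrow> ('k poly \<Rightarrow> 'k poly) \<Rightarrow> 'k poly \<Rightarrow> 'k poly" where
  "qtwist q a \<phi> p = \<phi> (pCons 0 p) - smult (q powi a) (pCons 0 (\<phi> p))"

lemma qcommutator_eq: "qcommutator q a \<phi> ((*) r) p = \<phi> (r * p) - qscale q a r * \<phi> p"
  by (simp add: qcommutator_def qsigma_mult)

lemma qcommutator_X: "qcommutator q a \<phi> ((*) [:0, 1:]) = qtwist q a \<phi>"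
  by (rule ext) (simp add: qcommutator_eq qtwist_def qscale_def pcompose_pCons)

lemma qtwist_commute: "qtwist q a (qtwist q b \<phi>) = qtwist q b (qtwist q a \<phi>)"
  by (intro ext poly_eqI) (simp add: qtwist_def coeff_pCons algebra_simps split: nat.split)

lemma qtwist_zero: "qtwist q a (\<lambda>_. 0) = (\<lambda>_. 0)"
  by (simp add: qtwist_def fun_eq_iff)

lemma qtwist_add: "qtwist q a (\<lambda>p. \<phi> p + \<psi> p) = (\<lambda>p. qtwist q a \<phi> p + qtwist q a \<psi> p)"
  by (intro ext poly_eqI) (simp add: qtwist_def coeff_pCons algebra_simps split: nat.split)

lemma homogeneous_qtwist:
  assumes "homogeneous d \<phi>"
  shows "homogeneous (d + 1) (qtwist q a \<phi>)"
proof -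
  let ?\<psi> = "smult (- (q powi a)) \<circ> (pCons 0 \<circ> \<phi>)"
  have "homogeneous (d + 1) (\<phi> \<circ> pCons 0)"
    using homogeneous_compose[OF assms homogeneous_pCons_0] by (simp only: add.commute)
  moreover have "homogeneous (d + 1) ?\<psi>"
    using homogeneous_compose[OF homogeneous_smult homogeneous_compose[OF homogeneous_pCons_0 assms]]
    by (simp only: add_0_right)
  ultimately have "homogeneous (d + 1) (\<lambda>p. (\<phi> \<circ> pCons 0) p + ?\<psi> p)"
    by (rule homogeneous_add)
  moreover have "qtwist q a \<phi> = (\<lambda>p. (\<phi> \<circ> pCons 0) p + ?\<psi> p)"
    by (simp add: qtwist_def fun_eq_iff)
  ultimately show ?thesis by metis
qed

lemma grHom_qtwist: "\<phi> \<in> grHom \<Longrightarrow> qtwist q a \<phi> \<in> grHom"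
proof (induction rule: grHom_induct)
  case zero
  show ?case
    by (simp add: qtwist_zero grHom_homogeneous[OF homogeneous_zero])
next
  case (add \<phi> \<psi> d)
  then show ?case
    by (simp add: qtwist_add grHom_add_homogeneous[OF _ homogeneous_qtwist])
qed

text \<open>
  Passing to \<open>[\<phi>, x]\<^sub>a\<close> raises degrees by one, hence respects the decomposition into homogeneous
  components up to that shift.
\<close>

lemma hom_component_qtwist:
  "\<phi> \<in> grHom \<Longrightarrow> hom_component (e + 1) (qtwist q a \<phi>) = qtwist q a (hom_component e \<phi>)"
proof (induction rule: grHom_induct)
  case zero
  show ?case by (simp add: qtwist_zero hom_component_zero)
next
  case (add \<phi> \<psi> d)
  have "hom_component (e + 1) (qtwist q a \<psi>) = qtwist q a (hom_component e \<psi>)"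
    using add.hyps(2)
    by (cases "e = d")
      (simp_all add: hom_component_homogeneous hom_component_homogeneous[OF homogeneous_qtwist]
        qtwist_zero)
  with add.IH show ?case
    by (simp add: qtwist_add hom_component_add)
qed

section \<open>Endomorphisms killed by iterated twisted commutators\<close>

text \<open>
  The maps annihilated by some finite product of the operators \<^term>\<open>qtwist q a\<close>, with varying \<open>a\<close>. Since
  these operators commute, their order in the product is immaterial.
\<close>

inductive qnil :: "'k::field \<Rightarrow> ('k poly \<Rightarrow> 'k poly) \<Rightarrow> bool" for q where
  zero: "qnil q (\<lambda>_. 0)"
| step: "qnil q (qtwist q a \<phi>) \<Longrightarrow> qnil q \<phi>"

lemma qnil_qtwist: "qnil q \<phi> \<Longrightarrow> qnil q (qtwist q a \<phi>)"
proof (induction rule: qnil.induct)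
  case zero
  show ?case by (simp add: qtwist_zero qnil.zero)
next
  case (step b \<phi>)
  then show ?case
    using qtwist_commute qnil.step by metis
qed

lemma qnil_add: "qnil q \<phi> \<Longrightarrow> qnil q \<psi> \<Longrightarrow> qnil q (\<lambda>p. \<phi> p + \<psi> p)"
proof (induction arbitrary: \<psi> rule: qnil.induct)
  case (step a \<phi>)
  from step.IH[OF qnil_qtwist[OF step.prems]]
  show ?case
    by - (rule qnil.step[of q a], simp only: qtwist_add)
qed simp

lemma qnil_of_commute: "(\<And>p. \<phi> (pCons 0 p) = smult (q powi a) (pCons 0 (\<phi> p))) \<Longrightarrow> qnil q \<phi>"
  by (rule qnil.step[of q a]) (simp add: qtwist_def[abs_def] qnil.zero)

lemma qnil_mult: "qnil q ((*) r)"
  by (rule qnil_of_commute[of _ _ 0]) simp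

lemma qnil_smult: "qnil q \<phi> \<Longrightarrow> qnil q (smult c \<circ> \<phi>)"
proof (induction rule: qnil.induct)
  case zero
  show ?case by (simp add: o_def qnil.zero)
next
  case (step a \<phi>)
  have "qtwist q a (smult c \<circ> \<phi>) = smult c \<circ> qtwist q a \<phi>"
    by (intro ext poly_eqI) (simp add: qtwist_def coeff_pCons algebra_simps split: nat.split)
  then show ?case
    using step.IH by - (rule qnil.step[of q a], simp only:)
qed

text \<open>
  The Leibniz rule: moving \<open>x\<close> to the left through \<open>\<psi>\<close> costs \<open>[\<psi>, x]\<^sub>b\<close> and a factor \<open>q\<^sup>b\<close>, and moving it on
  through \<open>\<phi>\<close> costs \<open>[\<phi>, x]\<^sub>a\<close> and a factor \<open>q\<^sup>a\<close>.
\<close>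

lemma qtwist_compose:
  assumes "q \<noteq> 0" "\<phi> \<in> grHom"
  shows "qtwist q (a + b) (\<phi> \<circ> \<psi>) =
    (\<lambda>p. (\<phi> \<circ> qtwist q b \<psi>) p + (qtwist q a \<phi> \<circ> (smult (q powi b) \<circ> \<psi>)) p)"
proof
  fix p
  have shift: "pCons 0 (smult c p) = smult c (pCons 0 p)" for c and p :: "'a poly"
    by simp
  show "qtwist q (a + b) (\<phi> \<circ> \<psi>) p =
      (\<phi> \<circ> qtwist q b \<psi>) p + (qtwist q a \<phi> \<circ> (smult (q powi b) \<circ> \<psi>)) p"
    using assms
    by (simp add: qtwist_def grHom_diff grHom_linear(2) power_int_add shift del: smult_pCons)
qed

text \<open>
  By the Leibniz rule, one twisted commutator of \<open>\<phi> \<circ> \<psi>\<close> is a sum of two compositions in which one of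
  the factors has a shorter annihilating product. This calls for an induction on \<open>\<psi>\<close> inside the induction
  on \<open>\<phi>\<close>.
\<close>

lemma qnil_compose:
  assumes "q \<noteq> 0"
  shows "qnil q \<phi> \<Longrightarrow> \<phi> \<in> grHom \<Longrightarrow> qnil q \<psi> \<Longrightarrow> qnil q (\<phi> \<circ> \<psi>)"
proof (induction arbitrary: \<psi> rule: qnil.induct)
  case zero
  show ?case by (simp add: o_def qnil.zero)
next
  case (step a \<phi>)
  have IH: "qnil q (qtwist q a \<phi> \<circ> \<psi>)" if "qnil q \<psi>" for \<psi>
    using step.IH grHom_qtwist step.prems(1) that by blast
  have \<phi>: "\<phi> \<in> grHom" by fact
  from step.prems(2) show ?case
  proof (induction rule: qnil.induct)
    case zero
    show ?case
      using grHom_eq_0[OF \<phi>] by (simp add: o_def qnil.zero)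
  next
    case (step b \<psi>)
    have "qnil q (smult (q powi b) \<circ> \<psi>)"
      by (rule qnil_smult[OF qnil.step[OF step.hyps]])
    from qnil_add[OF step.IH IH[OF this]]
    show ?case
      by - (rule qnil.step[of q "a + b"], simp only: qtwist_compose[OF assms \<phi>])
  qed
qed

section \<open>Description of the ring of q-differential operators\<close>

text \<open>
  With \<open>M = 0\<close> and \<open>M = D\<^sub>q\<^sup>n\<close> these are the bimodule generators of \<open>D\<^sub>q\<^sup>0\<close> and of \<open>D\<^sub>q\<^sup>n\<^sup>+\<^sup>1\<close>, so both clauses of
  \<^const>\<open>qdiff_upto\<close> take the same shape.
\<close>

definition qdiff_generators ::
    "'k::field \<Rightarrow> ('k poly \<Rightarrow> 'k poly) set \<Rightarrow> ('k poly \<Rightarrow> 'k poly) set" where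
  "qdiff_generators q M =
     {\<phi>. (\<exists>d. homogeneous d \<phi>) \<and> (\<exists>a. \<forall>r. qcommutator q a \<phi> ((*) r) \<in> M)}"

lemma qdiff_upto_0: "qdiff_upto q 0 = sub_bimodule hull qdiff_generators q {\<lambda>_. 0}"
  by (simp add: qdiff_generators_def)

lemma qdiff_upto_Suc: "qdiff_upto q (Suc n) = sub_bimodule hull qdiff_generators q (qdiff_upto q n)"
  by (simp add: qdiff_generators_def)

lemma qdiff_generators_grHom: "qdiff_generators q M \<subseteq> grHom"
  by (auto simp: qdiff_generators_def intro: grHom_homogeneous)

lemma qdiff_generators_mono: "M \<subseteq> M' \<Longrightarrow> qdiff_generators q M \<subseteq> qdiff_generators q M'"
  unfolding qdiff_generators_def by blast

text \<open>
  A hull is an intersection of sub-bimodules. The family is nonempty because \<^const>\<open>grHom\<close> belongs to it;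
  this keeps the intersection inside \<^const>\<open>grHom\<close>.
\<close>

lemma sub_bimodule_hull:
  assumes "S \<subseteq> grHom"
  shows "sub_bimodule (sub_bimodule hull S)"
proof -
  have "sub_bimodule hull S \<subseteq> grHom"
    by (rule hull_minimal[of S grHom sub_bimodule, OF assms sub_bimodule_grHom])
  moreover have "\<phi> \<in> sub_bimodule hull S \<longleftrightarrow> (\<forall>T. sub_bimodule T \<longrightarrow> S \<subseteq> T \<longrightarrow> \<phi> \<in> T)" for \<phi>
    by (auto simp: hull_def)
  ultimately show ?thesis
    by (simp add: sub_bimodule_def)
qed

lemma sub_bimodule_qdiff_upto: "sub_bimodule (qdiff_upto q n)"
proof (cases n)
  case 0
  show ?thesis
    unfolding 0 qdiff_upto_0 by (rule sub_bimodule_hull[OF qdiff_generators_grHom])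
next
  case (Suc m)
  show ?thesis
    unfolding Suc qdiff_upto_Suc by (rule sub_bimodule_hull[OF qdiff_generators_grHom])
qed

lemma qdiff_upto_mono:
  assumes "m \<le> n"
  shows "qdiff_upto q m \<subseteq> qdiff_upto q n"
proof -
  have "qdiff_upto q n \<subseteq> qdiff_upto q (Suc n)" for n
  proof (induction n)
    case 0
    have "{\<lambda>_. 0} \<subseteq> qdiff_upto q 0"
      using sub_bimoduleD(1)[OF sub_bimodule_qdiff_upto[of q 0]] by blast
    from hull_mono[OF qdiff_generators_mono[OF this]] show ?case
      unfolding qdiff_upto_Suc by (subst qdiff_upto_0)
  next
    case (Suc n)
    from hull_mono[OF qdiff_generators_mono[OF this]] show ?case
      by (simp only: qdiff_upto_Suc)
  qed
  then show ?thesis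
    using lift_Suc_mono_le[of "qdiff_upto q" m n] assms by blast
qed

lemma sub_bimodule_qnil:
  assumes "q \<noteq> 0"
  shows "sub_bimodule {\<phi> \<in> grHom. qnil q \<phi>}"
  unfolding sub_bimodule_def
proof (intro conjI ballI allI)
  show "(\<lambda>_. 0) \<in> {\<phi> \<in> grHom. qnil q \<phi>}"
    by (simp add: grHom_homogeneous[OF homogeneous_zero] qnil.zero)
next
  fix \<phi> \<psi>
  assume "\<phi> \<in> {\<phi> \<in> grHom. qnil q \<phi>}" "\<psi> \<in> {\<phi> \<in> grHom. qnil q \<phi>}"
  then show "(\<lambda>p. \<phi> p + \<psi> p) \<in> {\<phi> \<in> grHom. qnil q \<phi>}"
    by (simp add: grHom_add qnil_add)
next
  fix \<phi> r
  assume "\<phi> \<in> {\<phi> \<in> grHom. qnil q \<phi>}"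
  then show "(*) r \<circ> \<phi> \<in> {\<phi> \<in> grHom. qnil q \<phi>}" "\<phi> \<circ> (*) r \<in> {\<phi> \<in> grHom. qnil q \<phi>}"
    by (simp_all add: grHom_compose grHom_mult qnil_compose[OF assms] qnil_mult)
qed blast

lemma qdiff_generators_qnil:
  assumes "M \<subseteq> Collect (qnil q)"
  shows "qdiff_generators q M \<subseteq> Collect (qnil q)"
proof
  fix \<phi>
  assume "\<phi> \<in> qdiff_generators q M"
  then obtain a where "\<And>r. qcommutator q a \<phi> ((*) r) \<in> M"
    by (auto simp: qdiff_generators_def)
  from this[of "[:0, 1:]"] have "qtwist q a \<phi> \<in> M"
    by (simp only: qcommutator_X)
  then show "\<phi> \<in> Collect (qnil q)"
    using assms qnil.step by blast
qed

lemma qdiff_upto_qnil: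
  assumes "q \<noteq> 0"
  shows "qdiff_upto q n \<subseteq> {\<phi> \<in> grHom. qnil q \<phi>}"
proof (induction n)
  case 0
  have "qdiff_generators q {\<lambda>_. 0} \<subseteq> Collect (qnil q)"
    by (rule qdiff_generators_qnil) (simp add: qnil.zero)
  then show ?case
    unfolding qdiff_upto_0
    using qdiff_generators_grHom by (intro hull_minimal sub_bimodule_qnil[OF assms]) blast
next
  case (Suc n)
  then have "qdiff_generators q (qdiff_upto q n) \<subseteq> Collect (qnil q)"
    by (intro qdiff_generators_qnil) blast
  then show ?case
    unfolding qdiff_upto_Suc
    using qdiff_generators_grHom by (intro hull_minimal sub_bimodule_qnil[OF assms]) blast
qed

lemma qcommutator_pCons:
  assumes "\<phi> \<in> grHom"
  shows "qcommutator q a \<phi> ((*) (pCons c r)) =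
    (\<lambda>p. (qtwist q a \<phi> \<circ> (*) r) p + ((*) [:0, q powi a:] \<circ> qcommutator q a \<phi> ((*) r)) p)"
  by (rule ext)
    (simp add: qcommutator_eq qtwist_def qscale_pCons grHom_linear[OF assms] algebra_simps
      smult_diff_right)

text \<open>
  The algebra \<open>R\<close> is generated by \<open>x\<close>, and \<open>[\<phi>, x r]\<^sub>a = [\<phi>, x]\<^sub>a r + \<sigma>\<^sub>a(x) [\<phi>, r]\<^sub>a\<close>. Therefore the
  commutators with all \<open>r\<close> are controlled by the one with \<open>x\<close>.
\<close>

lemma qcommutator_in_sub_bimodule:
  assumes "sub_bimodule M" "\<phi> \<in> grHom" "qtwist q a \<phi> \<in> M"
  shows "qcommutator q a \<phi> ((*) r) \<in> M"
proof (induction r)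
  case 0
  have "qcommutator q a \<phi> ((*) 0) = (\<lambda>_. 0)"
    using grHom_eq_0[OF assms(2)] by (simp add: fun_eq_iff qcommutator_eq qscale_def)
  then show ?case
    by (simp only: sub_bimoduleD(1)[OF assms(1)])
next
  case (pCons c r)
  show ?case
    unfolding qcommutator_pCons[OF assms(2)]
    by (intro sub_bimoduleD(2)[OF assms(1)] sub_bimoduleD(3)[OF assms(1) pCons.IH]
        sub_bimoduleD(4)[OF assms(1,3)])
qed

text \<open>
  Each factor of the annihilating product raises the order \<open>n\<close> by one. Homogeneity is needed because the
  generators of \<open>D\<^sub>q\<^sup>n\<close> are homogeneous.
\<close>

lemma homogeneous_qnil_in_qdiff_upto:
  "qnil q \<phi> \<Longrightarrow> homogeneous d \<phi> \<Longrightarrow> \<exists>n. \<phi> \<in> qdiff_upto q n"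
proof (induction arbitrary: d rule: qnil.induct)
  case zero
  show ?case
    using sub_bimoduleD(1)[OF sub_bimodule_qdiff_upto] ..
next
  case (step a \<phi>)
  then obtain n where "qtwist q a \<phi> \<in> qdiff_upto q n"
    using homogeneous_qtwist by blast
  then have "qcommutator q a \<phi> ((*) r) \<in> qdiff_upto q n" for r
    by (intro qcommutator_in_sub_bimodule sub_bimodule_qdiff_upto grHom_homogeneous[OF step.prems])
  then have "\<phi> \<in> qdiff_generators q (qdiff_upto q n)"
    using step.prems unfolding qdiff_generators_def by blast
  then have "\<phi> \<in> qdiff_upto q (Suc n)"
    unfolding qdiff_upto_Suc by (rule hull_inc)
  then show ?case ..
qed

lemma qnil_hom_component:
  "qnil q \<phi> \<Longrightarrow> \<phi> \<in> grHom \<Longrightarrow> qnil q (hom_component e \<phi>)"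
proof (induction arbitrary: e rule: qnil.induct)
  case zero
  show ?case by (simp add: hom_component_zero qnil.zero)
next
  case (step a \<phi>)
  have "qnil q (hom_component (e + 1) (qtwist q a \<phi>))"
    by (intro step.IH grHom_qtwist step.prems)
  then show ?case
    by - (rule qnil.step[of q a], simp only: hom_component_qtwist[OF step.prems])
qed

theorem Union_qdiff_upto:
  assumes "q \<noteq> 0"
  shows "(\<Union>n. qdiff_upto q n) = {\<phi> \<in> grHom. qnil q \<phi>}"
proof (rule Set.equalityI)
  show "(\<Union>n. qdiff_upto q n) \<subseteq> {\<phi> \<in> grHom. qnil q \<phi>}"
    using qdiff_upto_qnil[OF assms] by blast
  show "{\<phi> \<in> grHom. qnil q \<phi>} \<subseteq> (\<Union>n. qdiff_upto q n)"
  proof clarify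
    fix \<phi> :: "'a poly \<Rightarrow> 'a poly"
    assume \<phi>: "\<phi> \<in> grHom" "qnil q \<phi>"
    obtain E where E: "finite E" "\<phi> = (\<lambda>p. \<Sum>e\<in>E. hom_component e \<phi> p)"
      using sum_hom_component[OF \<phi>(1)] .
    have "\<exists>n. (\<lambda>p. \<Sum>e\<in>E. hom_component e \<phi> p) \<in> qdiff_upto q n"
      using E(1)
    proof induction
      case empty
      have "(\<lambda>_. 0) \<in> qdiff_upto q 0"
        by (rule sub_bimoduleD(1)[OF sub_bimodule_qdiff_upto])
      then show ?case
        by (auto simp del: qdiff_upto.simps)
    next
      case (insert e E)
      then obtain m where "(\<lambda>p. \<Sum>e\<in>E. hom_component e \<phi> p) \<in> qdiff_upto q m"
        by blast
      moreover obtain n where "hom_component e \<phi> \<in> qdiff_upto q n"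
        using homogeneous_qnil_in_qdiff_upto qnil_hom_component[OF \<phi>(2,1)]
          homogeneous_hom_component[OF \<phi>(1)] by blast
      ultimately have "(\<lambda>p. \<Sum>e\<in>E. hom_component e \<phi> p) \<in> qdiff_upto q (max m n)"
        "hom_component e \<phi> \<in> qdiff_upto q (max m n)"
        using qdiff_upto_mono max.cobounded1 max.cobounded2 by blast+
      then have "(\<lambda>p. hom_component e \<phi> p + (\<Sum>e\<in>E. hom_component e \<phi> p)) \<in> qdiff_upto q (max m n)"
        by (intro sub_bimoduleD(2)[OF sub_bimodule_qdiff_upto])
      then show ?case
        using insert.hyps by auto
    qed
    then show "\<phi> \<in> (\<Union>n. qdiff_upto q n)"
      using E(2) by simp
  qed
qed

section \<open>The ring axioms\<close>

lemma qdiff_ring_simps: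
  "mult (qdiff_ring q) = (\<circ>)" "one (qdiff_ring q) = id"
  "zero (qdiff_ring q) = (\<lambda>_. 0)" "add (qdiff_ring q) = (\<lambda>\<phi> \<psi> p. \<phi> p + \<psi> p)"
  by (simp_all add: qdiff_ring_def)

lemma carrier_qdiff_ring:
  "q \<noteq> 0 \<Longrightarrow> carrier (qdiff_ring q) = {\<phi> \<in> grHom. qnil q \<phi>}"
  by (simp add: qdiff_ring_def Union_qdiff_upto)

lemma mult_in_carrier: "q \<noteq> 0 \<Longrightarrow> (*) r \<in> carrier (qdiff_ring q)"
  by (simp add: carrier_qdiff_ring grHom_mult qnil_mult)

lemma id_in_carrier:
  assumes "q \<noteq> 0"
  shows "id \<in> carrier (qdiff_ring q)"
proof -
  have "(*) 1 = (id :: 'a poly \<Rightarrow> 'a poly)"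
    by (simp add: fun_eq_iff)
  then show ?thesis
    using mult_in_carrier[OF assms, of 1] by simp
qed

lemma qscale_in_carrier:
  assumes "q \<noteq> 0"
  shows "qscale q a \<in> carrier (qdiff_ring q)"
proof -
  have "homogeneous 0 (qscale q a)"
    by (simp add: homogeneous_iff graded_piece_iff coeff_qscale)
      (simp add: qscale_def pcompose_add pcompose_smult)
  moreover have "qnil q (qscale q a)"
    by (rule qnil_of_commute[of _ q a]) (simp add: qscale_pCons)
  ultimately show ?thesis
    using assms by (simp add: carrier_qdiff_ring grHom_homogeneous)
qed

lemma pderiv_in_carrier:
  assumes "q \<noteq> 0"
  shows "pderiv \<in> carrier (qdiff_ring q)"
proof -
  have "homogeneous (- 1) pderiv"
    by (auto simp: homogeneous_iff graded_piece_iff coeff_pderiv pderiv_add pderiv_smult)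
  moreover have "qtwist q 0 pderiv = (\<lambda>p. p)"
    by (simp add: fun_eq_iff qtwist_def pderiv_pCons)
  moreover have "qnil q (\<lambda>p. p)"
    by (rule qnil_of_commute[of _ _ 0]) simp
  ultimately show ?thesis
    using assms qnil.step[of q 0 pderiv] grHom_homogeneous[of "- 1" pderiv]
    by (simp add: carrier_qdiff_ring)
qed

lemma ring_qdiff_ring:
  assumes "q \<noteq> 0"
  shows "ring (qdiff_ring q)"
proof -
  have bimod: "sub_bimodule (carrier (qdiff_ring q))"
    using sub_bimodule_qnil[OF assms] by (simp add: carrier_qdiff_ring[OF assms])
  have gr: "\<phi> \<in> grHom" if "\<phi> \<in> carrier (qdiff_ring q)" for \<phi>
    using that by (simp add: carrier_qdiff_ring[OF assms])
  have inverse: "\<exists>\<psi>\<in>carrier (qdiff_ring q). (\<lambda>p. \<psi> p + \<phi> p) = (\<lambda>_. 0)"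
    if "\<phi> \<in> carrier (qdiff_ring q)" for \<phi>
  proof (rule bexI)
    show "(*) (- 1) \<circ> \<phi> \<in> carrier (qdiff_ring q)"
      by (rule sub_bimoduleD(3)[OF bimod that])
  qed simp
  have "abelian_group (qdiff_ring q)"
    by (rule abelian_groupI; simp only: qdiff_ring_simps)
      (use sub_bimoduleD(1,2)[OF bimod] inverse in \<open>auto simp: add_ac\<close>)
  moreover have "id \<in> carrier (qdiff_ring q)"
    by (rule id_in_carrier[OF assms])
  then have "monoid (qdiff_ring q)"
    by (intro monoidI; simp only: qdiff_ring_simps)
      (auto simp: carrier_qdiff_ring[OF assms] grHom_compose qnil_compose[OF assms] comp_assoc)
  ultimately show ?thesis
    by (rule ringI; simp only: qdiff_ring_simps)
      (simp_all add: fun_eq_iff grHom_linear(1)[OF gr])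
qed

section \<open>Simplicity\<close>

text \<open>
  The relation \<open>\<phi> x = q\<^sup>a x \<phi>\<close> determines \<open>\<phi>\<close> on all powers of \<open>x\<close> from its value at \<open>1\<close>.
\<close>

lemma eq_mult_qscale:
  assumes "\<phi> \<in> grHom" "qtwist q a \<phi> = (\<lambda>_. 0)"
  shows "\<phi> p = \<phi> 1 * qscale q a p"
proof (induction p)
  case 0
  show ?case
    using grHom_eq_0[OF assms(1)] by (simp add: qscale_def)
next
  case (pCons c p)
  have "pCons c p = smult c 1 + pCons 0 p"
    by simp
  then have "\<phi> (pCons c p) = smult c (\<phi> 1) + \<phi> (pCons 0 p)"
    using grHom_linear[OF assms(1)] by metis
  also have "\<phi> (pCons 0 p) = smult (q powi a) (pCons 0 (\<phi> p))"
    using fun_cong[OF assms(2), of p] by (simp add: qtwist_def)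
  finally show ?case
    by (subst qscale_pCons) (simp add: pCons.IH distrib_left)
qed

lemma qscale_qscale_uminus:
  assumes "q \<noteq> 0"
  shows "qscale q a (qscale q (- a) p) = p"
  using assms by (intro poly_eqI) (simp add: coeff_qscale power_int_minus flip: power_mult_distrib)

text \<open>
  The annihilating product of \<open>\<phi>\<close> is applied factor by factor; \<open>\<psi>\<close> is the last nonzero map obtained.
\<close>

lemma exists_qtwist_eq_zero:
  assumes "\<And>\<phi> a. \<phi> \<in> I \<Longrightarrow> qtwist q a \<phi> \<in> I"
  shows "qnil q \<phi> \<Longrightarrow> \<phi> \<in> I \<Longrightarrow> \<phi> \<noteq> (\<lambda>_. 0) \<Longrightarrow>
    \<exists>\<psi>\<in>I. \<psi> \<noteq> (\<lambda>_. 0) \<and> (\<exists>a. qtwist q a \<psi> = (\<lambda>_. 0))"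
proof (induction rule: qnil.induct)
  case (step a \<phi>)
  then show ?case
    using assms by (cases "qtwist q a \<phi> = (\<lambda>_. 0)") blast+
qed simp

text \<open>
  In characteristic zero differentiation lowers a positive degree by exactly one, so it cannot kill a
  nonconstant polynomial.
\<close>

lemma exists_const_mult:
  fixes I :: "('k::field_char_0 poly \<Rightarrow> 'k poly) set"
  assumes "\<And>r. (*) r \<in> I \<Longrightarrow> (*) (pderiv r) \<in> I"
  shows "(*) r \<in> I \<Longrightarrow> r \<noteq> 0 \<Longrightarrow> \<exists>c. c \<noteq> 0 \<and> (*) [:c:] \<in> I"
proof (induction "degree r" arbitrary: r rule: less_induct)
  case less
  show ?case
  proof (cases "degree r = 0")
    case True
    then show ?thesis
      using less.prems by (metis degree_eq_zeroE pCons_0_0)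
  next
    case False
    then have "pderiv r \<noteq> 0" "degree (pderiv r) < degree r"
      by (simp_all add: pderiv_eq_0_iff degree_pderiv)
    then show ?thesis
      using less assms by blast
  qed
qed

lemma ideal_eq_carrier:
  fixes q :: "'k::field_char_0"
  assumes "q \<noteq> 0" and "ideal I (qdiff_ring q)" and "I \<noteq> {\<lambda>_. 0}"
  shows "I = carrier (qdiff_ring q)"
proof -
  interpret ideal I "qdiff_ring q" by fact
  have I_carrier: "\<phi> \<in> grHom" "qnil q \<phi>" if "\<phi> \<in> I" for \<phi>
    using a_subset that by (auto simp: carrier_qdiff_ring[OF assms(1)])
  have left: "\<psi> \<circ> \<phi> \<in> I" and right: "\<phi> \<circ> \<psi> \<in> I"
    if "\<phi> \<in> I" "\<psi> \<in> carrier (qdiff_ring q)" for \<phi> \<psi>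
    using I_l_closed[OF that] I_r_closed[OF that] by (simp_all add: qdiff_ring_simps)
  have mult_l: "(\<lambda>p. r * \<phi> p) \<in> I" if "\<phi> \<in> I" for \<phi> r
    using left[OF that mult_in_carrier[OF assms(1), of r]] by (simp add: o_def)
  have add: "(\<lambda>p. \<phi> p + \<psi> p) \<in> I" if "\<phi> \<in> I" "\<psi> \<in> I" for \<phi> \<psi>
    using additive_subgroup.a_closed[OF additive_subgroup_axioms that] by (simp add: qdiff_ring_simps)
  have diff: "(\<lambda>p. \<phi> p - \<psi> p) \<in> I" if "\<phi> \<in> I" "\<psi> \<in> I" for \<phi> \<psi>
    using add[OF that(1) mult_l[OF that(2), of "- 1"]] by simp
  have twist: "qtwist q a \<phi> \<in> I" if "\<phi> \<in> I" for a \<phi>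
  proof -
    (* [:0, 1:] is the indeterminate, so the difference below is the twisted commutator with it. *)
    have "(\<lambda>p. (\<phi> \<circ> (*) [:0, 1:]) p - [:0, q powi a:] * \<phi> p) \<in> I"
      by (intro diff mult_l right mult_in_carrier assms(1) that)
    also have "(\<lambda>p. (\<phi> \<circ> (*) [:0, 1:]) p - [:0, q powi a:] * \<phi> p) = qtwist q a \<phi>"
      by (simp add: qtwist_def fun_eq_iff)
    finally show ?thesis .
  qed
  have deriv: "(*) (pderiv r) \<in> I" if "(*) r \<in> I" for r
  proof -
    have "(\<lambda>p. (pderiv \<circ> (*) r) p - ((*) r \<circ> pderiv) p) \<in> I"
      by (intro diff left right pderiv_in_carrier assms(1) that)
    also have "(\<lambda>p. (pderiv \<circ> (*) r) p - ((*) r \<circ> pderiv) p) = (*) (pderiv r)"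
      by (simp add: pderiv_mult fun_eq_iff algebra_simps)
    finally show ?thesis .
  qed
  have "(\<lambda>_. 0) \<in> I"
    using additive_subgroup.zero_closed[OF additive_subgroup_axioms]
    by (simp add: qdiff_ring_simps)
  then obtain \<phi> where "\<phi> \<in> I" "\<phi> \<noteq> (\<lambda>_. 0)"
    using assms(3) by blast
  then obtain \<psi> a where \<psi>: "\<psi> \<in> I" "\<psi> \<noteq> (\<lambda>_. 0)" "qtwist q a \<psi> = (\<lambda>_. 0)"
    using exists_qtwist_eq_zero[OF twist I_carrier(2)] by blast
  note \<psi>_eq = eq_mult_qscale[OF I_carrier(1)[OF \<psi>(1)] \<psi>(3)]
  have "\<psi> 1 \<noteq> 0"
    using \<psi>(2) \<psi>_eq by (metis mult_zero_left ext)
  \<comment> \<open>Undo the automorphism \<open>\<sigma>\<^sub>a\<close> in \<open>\<psi> = \<psi>(1) \<sigma>\<^sub>a\<close> by composing with its inverse.\<close>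
  moreover have "\<psi> \<circ> qscale q (- a) = (*) (\<psi> 1)"
    by (rule ext) (simp add: \<psi>_eq[of "qscale q (- a) _"] qscale_qscale_uminus[OF assms(1)])
  then have "(*) (\<psi> 1) \<in> I"
    using right[OF \<psi>(1) qscale_in_carrier[OF assms(1)]] by metis
  ultimately obtain c where c: "c \<noteq> 0" "(*) [:c:] \<in> I"
    using exists_const_mult[of I, OF deriv] by blast
  from mult_l[OF c(2), of "[:inverse c:]"] c(1) have "id \<in> I"
    by (simp add: id_def)
  then show ?thesis
    using one_imp_carrier by (simp add: qdiff_ring_simps)
qed

theorem theorem2p0p2:
  fixes q :: "'k::field_char_0"
  assumes "\<not> algebraic q"
  shows "simple_ring (qdiff_ring q)"
proof -
  have q: "q \<noteq> 0"
    using assms by auto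
  have "id \<in> carrier (qdiff_ring q)"
    by (rule id_in_carrier[OF q])
  moreover have "id \<noteq> (\<lambda>_ :: 'k poly. 0 :: 'k poly)"
    by (metis id_apply zero_neq_one)
  ultimately show ?thesis
    using ring_qdiff_ring[OF q] ideal_eq_carrier[OF q]
    unfolding simple_ring_def qdiff_ring_simps by blast
qed

end
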